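(* Let $G$ be a chordal graph. If $G$ is a clique, then $b(G)=\lceil \omega(G)/2\rceil$. Otherwise, $b(G)\leq \omega(G)\leq \Delta(G)$.
   Context: All graphs are finite and simple. A graph is chordal if it has no induced cycle of length four or more. A graph is a clique if any two distinct vertices of it are adjacent. $\omega(G)$ is the number of vertices of a maximum clique of $G$ and $\Delta(G)$ is the maximum degree of $G$. A dominating set of $G$ is a set $S\subseteq V(G)$ such that every vertex of $G$ belongs to $S$ or has a neighbor in $S$; $\gamma(G)$ is the minimum cardinality of a dominating set of $G$. The bondage number $b(G)$ is the smallest cardinality of a set of edges $A\subseteq E(G)$ such that $\gamma(G-A)=\gamma(G)+1$, where $G-A$ is the graph obtained from $G$ by deleting the edges of $A$ (keeping all vertices).
   Formalization: The graph is assumed to have at least one edge (otherwise b(G) is undefined, e.g. for a single vertex), and ω(G) ≤ Δ(G) is claimed only for connected G (two disjoint edges give ω = 2 > Δ = 1); b(G) ≤ ω(G) is proved without connectedness. *)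

theory Defs
  imports Complex_Main "HOL-Library.Extended_Nat"
begin

definition simple_graph :: "'a set \<Rightarrow> 'a set set \<Rightarrow> bool" where
  "simple_graph V E \<longleftrightarrow> finite V \<and> (\<forall>e\<in>E. e \<subseteq> V \<and> card e = 2)"

definition clique_in :: "'a set \<Rightarrow> 'a set set \<Rightarrow> 'a set \<Rightarrow> bool" where
  "clique_in V E C \<longleftrightarrow> C \<subseteq> V \<and> (\<forall>u\<in>C. \<forall>v\<in>C. u \<noteq> v \<longrightarrow> {u, v} \<in> E)"

definition clique_graph :: "'a set \<Rightarrow> 'a set set \<Rightarrow> bool" where
  "clique_graph V E \<longleftrightarrow> clique_in V E V"

definition clique_number :: "'a set \<Rightarrow> 'a set set \<Rightarrow> nat" where
  "clique_number V E = Max (card ` {C. clique_in V E C})"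

definition vertex_degree :: "'a set set \<Rightarrow> 'a \<Rightarrow> nat" where
  "vertex_degree E v = card {u. {u, v} \<in> E}"

definition max_degree :: "'a set \<Rightarrow> 'a set set \<Rightarrow> nat" where
  "max_degree V E = Max (vertex_degree E ` V)"

definition connected_graph :: "'a set \<Rightarrow> 'a set set \<Rightarrow> bool" where
  "connected_graph V E \<longleftrightarrow>
     V \<noteq> {} \<and> (\<forall>u\<in>V. \<forall>v\<in>V. (u, v) \<in> {(x, y). {x, y} \<in> E}\<^sup>*)"

definition induced_cycle :: "'a set \<Rightarrow> 'a set set \<Rightarrow> 'a list \<Rightarrow> bool" where
  "induced_cycle V E vs \<longleftrightarrow>
     length vs \<ge> 3 \<and> distinct vs \<and> set vs \<subseteq> V \<and>
     (\<forall>i<length vs. \<forall>j<length vs.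
        {vs ! i, vs ! j} \<in> E \<longleftrightarrow>
          j = Suc i mod length vs \<or> i = Suc j mod length vs)"

definition chordal :: "'a set \<Rightarrow> 'a set set \<Rightarrow> bool" where
  "chordal V E \<longleftrightarrow> \<not> (\<exists>vs. induced_cycle V E vs \<and> length vs \<ge> 4)"

definition dominating_set :: "'a set \<Rightarrow> 'a set set \<Rightarrow> 'a set \<Rightarrow> bool" where
  "dominating_set V E S \<longleftrightarrow> S \<subseteq> V \<and> (\<forall>v\<in>V. v \<in> S \<or> (\<exists>u\<in>S. {u, v} \<in> E))"

definition domination_number :: "'a set \<Rightarrow> 'a set set \<Rightarrow> nat" where
  "domination_number V E = Min (card ` {S. dominating_set V E S})"

text \<open>The bondage number is \<open>\<infinity>\<close> when no set of edges qualifies; for a finite simple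
  graph this happens exactly when the graph has no edges.\<close>

definition bondage_number :: "'a set \<Rightarrow> 'a set set \<Rightarrow> enat" where
  "bondage_number V E =
     (INF A \<in> {A. A \<subseteq> E \<and> domination_number V (E - A) = domination_number V E + 1}.
        enat (card A))"

end

theory Submission
  imports Defs
begin

text \<open>
  For the bound \<open>b(G) \<le> \<omega>(G)\<close>, two adjacent simplicial vertices \<open>u, w\<close> have the same closed
  neighbourhood, and isolating \<open>u\<close> raises the domination number.  If no two simplicial vertices are
  adjacent, delete all of them and let \<open>y\<close> be a simplicial vertex of the remaining chordal graph,
  with closed neighbourhood \<open>K\<close> there.  As \<open>y\<close> is not simplicial in \<open>G\<close>, it has a simplicial
  neighbour \<open>u\<close>, and \<open>N(u) \<subseteq> K\<close>.  Delete the \<open>|N(u)|\<close> edges at \<open>u\<close> and the edges from \<open>y\<close> to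
  \<open>K - N(u)\<close>, which are \<open>|K| \<le> \<omega>(G)\<close> edges in total.  A dominating set of the resulting graph
  contains \<open>u\<close> and some \<open>z\<close> dominating \<open>y\<close>, where \<open>z\<close> is in \<open>N(u)\<close> or is a simplicial neighbour
  of \<open>y\<close>; in the latter case \<open>z\<close> may be replaced by \<open>y\<close>.  Either way \<open>u\<close> becomes superfluous in \<open>G\<close>.

  For a clique, the domination number rises exactly when the deleted edges cover all vertices.
\<close>

section \<open>Closed neighbourhoods, cliques and simplicial vertices\<close>

definition closed_nbhd :: "'a set set \<Rightarrow> 'a \<Rightarrow> 'a set" where
  "closed_nbhd E v = {u. u = v \<or> {u, v} \<in> E}"

text \<open>Induced subgraphs are handled by shrinking \<open>V\<close> while keeping all of
  \<open>E\<close>. Since \<open>closed_nbhd E s\<close> may then leave \<open>V\<close>, it is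
  intersected with \<open>V\<close>.\<close>

definition simplicial :: "'a set \<Rightarrow> 'a set set \<Rightarrow> 'a \<Rightarrow> bool" where
  "simplicial V E s \<longleftrightarrow> s \<in> V \<and> clique_in V E (V \<inter> closed_nbhd E s)"

lemma closed_nbhd_self [simp]: "v \<in> closed_nbhd E v"
  by (simp add: closed_nbhd_def)

lemma closed_nbhd_sym: "u \<in> closed_nbhd E v \<longleftrightarrow> v \<in> closed_nbhd E u"
  by (auto simp: closed_nbhd_def insert_commute)

lemma edge_subset: "simple_graph V E \<Longrightarrow> {a, b} \<in> E \<Longrightarrow> a \<in> V \<and> b \<in> V"
  by (auto simp: simple_graph_def)

lemma edge_neq: "simple_graph V E \<Longrightarrow> {a, b} \<in> E \<Longrightarrow> a \<noteq> b"
  by (fastforce simp: simple_graph_def)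

lemma closed_nbhd_subset: "simple_graph V E \<Longrightarrow> v \<in> V \<Longrightarrow> closed_nbhd E v \<subseteq> V"
  using edge_subset[of V E] by (fastforce simp: closed_nbhd_def)

lemma simple_graph_finite: "simple_graph V E \<Longrightarrow> finite V"
  by (simp add: simple_graph_def)

lemma simple_graph_finite_edges: "simple_graph V E \<Longrightarrow> finite E"
  by (rule finite_subset[of _ "Pow V"]) (auto simp: simple_graph_def)

lemma simple_graph_edges_subset: "simple_graph V E \<Longrightarrow> F \<subseteq> E \<Longrightarrow> simple_graph V F"
  by (auto simp: simple_graph_def)

lemma clique_card_le:
  assumes "finite V" "clique_in V E C"
  shows "card C \<le> clique_number V E"
proof -
  have "finite {C. clique_in V E C}"
    by (rule finite_subset[of _ "Pow V"]) (auto simp: clique_in_def assms)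
  then show ?thesis
    unfolding clique_number_def using assms by (intro Max_ge) auto
qed

lemma maximum_clique_exists:
  assumes "finite V"
  shows "\<exists>C. clique_in V E C \<and> card C = clique_number V E"
proof -
  have "finite {C. clique_in V E C}"
    by (rule finite_subset[of _ "Pow V"]) (auto simp: clique_in_def assms)
  moreover have "{} \<in> {C. clique_in V E C}"
    by (simp add: clique_in_def)
  ultimately have "clique_number V E \<in> card ` {C. clique_in V E C}"
    unfolding clique_number_def by (intro Max_in) auto
  then show ?thesis by auto
qed

lemma clique_in_subset: "clique_in V E C \<Longrightarrow> B \<subseteq> C \<Longrightarrow> clique_in V E B"
  unfolding clique_in_def by blast

lemma clique_in_mono: "clique_in W E C \<Longrightarrow> W \<subseteq> V \<Longrightarrow> clique_in V E C"
  unfolding clique_in_def by blast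

lemma not_clique_nonneighbour: "\<not> clique_in V E V \<Longrightarrow> \<exists>w\<in>V. \<not> V \<subseteq> closed_nbhd E w"
  unfolding clique_in_def closed_nbhd_def by blast

lemma simplicial_closed_nbhd_clique:
  assumes "simple_graph V E" "simplicial V E s"
  shows "clique_in V E (closed_nbhd E s)"
  using assms closed_nbhd_subset[of V E s] by (simp add: simplicial_def Int_absorb1)

text \<open>The closed neighbourhood of \<open>s\<close> is a clique containing \<open>y\<close>, so
  each of its members is \<open>y\<close> or a neighbour of \<open>y\<close>. Hence in a dominating
  set \<open>s\<close> can be replaced by any of its neighbours.\<close>

lemma simplicial_closed_nbhd_subset:
  assumes "simple_graph V E" "simplicial V E s" "y \<in> closed_nbhd E s"
  shows "closed_nbhd E s \<subseteq> closed_nbhd E y"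
  using simplicial_closed_nbhd_clique[OF assms(1,2)] assms(3)
  by (fastforce simp: clique_in_def closed_nbhd_def)

subsection \<open>Simplicial vertices of chordal graphs\<close>

lemma chordal_subset: "chordal V E \<Longrightarrow> W \<subseteq> V \<Longrightarrow> chordal W E"
  unfolding chordal_def induced_cycle_def by (meson subset_trans)

text \<open>Take a walk with the fewest steps: a forward chord other than a step, or a repeated
  vertex, would let a prefix and a suffix be spliced into a shorter walk. The absence of chords is
  what later makes a cycle induced.\<close>

lemma shortest_walk:
  assumes "(x, y) \<in> R\<^sup>*"
  obtains f n where "f 0 = x" "f n = y" "\<And>i. i < n \<Longrightarrow> (f i, f (Suc i)) \<in> R"
    "\<And>i j. i < j \<Longrightarrow> j \<le> n \<Longrightarrow> (f i, f j) \<in> R \<Longrightarrow> j = Suc i"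
    "inj_on f {..n}"
proof -
  define n where "n = (LEAST n. (x, y) \<in> R ^^ n)"
  have "\<exists>n. (x, y) \<in> R ^^ n"
    using assms by (simp add: rtrancl_power)
  then have "(x, y) \<in> R ^^ n"
    unfolding n_def by (rule LeastI_ex)
  then obtain f where f: "f 0 = x" "f n = y" "\<And>i. i < n \<Longrightarrow> (f i, f (Suc i)) \<in> R"
    by (auto simp: relpow_fun_conv)
  have least: "n \<le> m" if "(x, y) \<in> R ^^ m" for m
    unfolding n_def using that by (rule Least_le)
  have seg: "(f i, f (i + k)) \<in> R ^^ k" if "i + k \<le> n" for i k
    using that by (induction k) (auto intro!: relcompI f(3))
  have pre: "(x, f i) \<in> R ^^ i" if "i \<le> n" for i
    using seg[of 0 i] that f(1) by simp
  have suf: "(f j, y) \<in> R ^^ (n - j)" if "j \<le> n" for j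
    using seg[of j "n - j"] that f(2) by simp
  have short: "j = Suc i" if "i < j" "j \<le> n" "(f i, f j) \<in> R" for i j
  proof -
    have "(x, f j) \<in> R ^^ Suc i"
      using pre[of i] that by auto
    then have "(x, y) \<in> R ^^ (Suc i + (n - j))"
      unfolding relpow_add using suf[of j] that by blast
    from least[OF this] that show ?thesis by simp
  qed
  have neq: "f i \<noteq> f j" if "i < j" "j \<le> n" for i j
  proof
    assume "f i = f j"
    then have "(x, y) \<in> R ^^ (i + (n - j))"
      unfolding relpow_add using suf[of j] pre[of i] that by auto
    from least[OF this] that show False by simp
  qed
  have "inj_on f {..n}"
    by (rule inj_onI) (metis atMost_iff neq linorder_neqE_nat)
  with f short show thesis using that by blast
qed

text \<open>If \<open>x\<close> and \<open>y\<close> were not adjacent, a shortest walk between them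
  with interior in \<open>C\<close> would close up through \<open>v\<close> to an induced cycle of
  length at least four.\<close>

lemma common_neighbours_adjacent:
  assumes ch: "chordal V E" and loopfree: "\<And>a b. {a, b} \<in> E \<Longrightarrow> a \<noteq> b"
    and v: "v \<in> V" and C: "C \<subseteq> V" "C \<inter> closed_nbhd E v = {}"
    and xy: "x \<in> V" "y \<in> V" "{x, v} \<in> E" "{y, v} \<in> E" "x \<noteq> y"
    and walk: "(x, y) \<in> {(a, b). {a, b} \<in> E \<and> a \<in> insert x (insert y C) \<and> b \<in> insert x (insert y C)}\<^sup>*"
  shows "{x, y} \<in> E"
proof (rule ccontr)
  assume nonadj: "{x, y} \<notin> E"
  let ?W = "insert x (insert y C)"
  let ?R = "{(a, b). {a, b} \<in> E \<and> a \<in> ?W \<and> b \<in> ?W}"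
  obtain f n where f: "f 0 = x" "f n = y" "\<And>i. i < n \<Longrightarrow> (f i, f (Suc i)) \<in> ?R"
    "\<And>i j. i < j \<Longrightarrow> j \<le> n \<Longrightarrow> (f i, f j) \<in> ?R \<Longrightarrow> j = Suc i" "inj_on f {..n}"
    using shortest_walk[OF walk] by blast
  \<comment> \<open>Together with \<open>n1\<close> this gives n \<ge> 2, so the cycle on
    \<open>v\<close> and the n + 1 walk vertices has length at least four.\<close>
  have n0: "n \<noteq> 0" using f(1,2) xy(5) by (metis)
  have n1: "n \<noteq> 1" using f(1,2) f(3)[of 0] nonadj by auto
  have inW: "f i \<in> ?W" if "i \<le> n" for i
  proof (cases "i = n")
    case False
    then show ?thesis using f(3)[of i] that by simp
  qed (simp add: f)
  have adj: "{f i, f j} \<in> E \<longleftrightarrow> j = Suc i \<or> i = Suc j" if "i \<le> n" "j \<le> n" for i j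
  proof -
    have *: "{f i, f j} \<in> E \<longleftrightarrow> j = Suc i" if "i < j" "j \<le> n" for i j
      using f(4)[of i j] f(3)[of i] that inW[of i] inW[of j] by auto
    consider "i < j" | "j < i" | "i = j" by linarith
    then show ?thesis
      using *[of i j] *[of j i] that loopfree[of "f i" "f j"] by cases (auto simp: insert_commute)
  qed
  have interior: "f i \<in> C" if "0 < i" "i < n" for i
  proof -
    have "f i \<noteq> f 0" "f i \<noteq> f n"
      using f(5) that by (auto simp: inj_on_def)
    then show ?thesis using inW[of i] that f by auto
  qed
  \<comment> \<open>Interior vertices of the walk lie in \<open>C\<close>, which avoids the closed
    neighbourhood of \<open>v\<close>, so no chord starts at \<open>v\<close>.\<close>
  have adjv: "{v, f i} \<in> E \<longleftrightarrow> i = 0 \<or> i = n" if "i \<le> n" for i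
    using interior[of i] that C(2) f(1,2) xy(3,4)
    by (cases "i = 0 \<or> i = n") (auto simp: closed_nbhd_def insert_commute)
  have vnot: "v \<noteq> f i" if "i \<le> n" for i
    using inW[OF that] C(2) loopfree[OF xy(3)] loopfree[OF xy(4)] by (auto simp: closed_nbhd_def)
  \<comment> \<open>Putting \<open>v\<close> first shifts the walk indices by one; the wrap-around
    edge of the cycle joins \<open>f n\<close> to \<open>v\<close>.\<close>
  let ?vs = "v # map f [0..<Suc n]"
  have len: "length ?vs = n + 2" by simp
  have nth: "?vs ! i = (if i = 0 then v else f (i - 1))" if "i < n + 2" for i
    using that by (cases i) (auto simp del: upt_Suc)
  have "induced_cycle V E ?vs"
    unfolding induced_cycle_def
  proof (intro conjI allI impI)
    show "3 \<le> length ?vs" using n0 by simp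
    show "distinct ?vs"
      using vnot f(5) set_upt[of 0 "Suc n"] unfolding atLeast0LessThan lessThan_Suc_atMost
      by (auto simp: distinct_map simp del: upt_Suc)
    show "set ?vs \<subseteq> V"
      using v inW C(1) xy by (fastforce simp: less_Suc_eq_le simp del: upt_Suc)
    fix i j assume "i < length ?vs" "j < length ?vs"
    then have ij: "i < n + 2" "j < n + 2" by simp_all
    have "{?vs ! i, ?vs ! j} \<in> E \<longleftrightarrow> j = Suc i mod (n + 2) \<or> i = Suc j mod (n + 2)"
    proof -
      consider "i = 0" "j = 0" | "i = 0" "0 < j" | "0 < i" "j = 0" | "0 < i" "0 < j" by blast
      then show ?thesis
      proof cases
        case 1
        then show ?thesis using loopfree[of v v] by auto
      next
        case 2
        then show ?thesis unfolding nth[OF ij(1)] nth[OF ij(2)]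
          using adjv[of "j - 1"] ij n0 by (auto simp: mod_Suc)
      next
        case 3
        then show ?thesis unfolding nth[OF ij(1)] nth[OF ij(2)]
          using adjv[of "i - 1"] ij n0 by (auto simp: mod_Suc insert_commute)
      next
        case 4
        then show ?thesis unfolding nth[OF ij(1)] nth[OF ij(2)]
          using adj[of "i - 1" "j - 1"] ij n0 by (auto simp: mod_Suc)
      qed
    qed
    then show "{?vs ! i, ?vs ! j} \<in> E \<longleftrightarrow> j = Suc i mod length ?vs \<or> i = Suc j mod length ?vs"
      unfolding len .
  qed
  moreover have "length ?vs \<ge> 4" using n0 n1 by simp
  ultimately show False using ch unfolding chordal_def by blast
qed

text \<open>Dirac's theorem, strengthened so that the induction goes through.\<close>

lemma simplicial_nonneighbour_exists:
  assumes "finite V" "chordal V E" and loopfree: "\<And>a b. {a, b} \<in> E \<Longrightarrow> a \<noteq> b"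
    and "v \<in> V" "\<not> V \<subseteq> closed_nbhd E v"
  shows "\<exists>s. simplicial V E s \<and> s \<notin> closed_nbhd E v"
  using assms(1,2,4,5)
proof (induction V arbitrary: v rule: finite_psubset_induct)
  case (psubset V)
  obtain c0 where c0: "c0 \<in> V" "c0 \<notin> closed_nbhd E v" using psubset.prems by blast
  let ?Q = "{(a, b). {a, b} \<in> E \<and> a \<in> V - closed_nbhd E v \<and> b \<in> V - closed_nbhd E v}"
  \<comment> \<open>\<open>C\<close> is the component of \<open>c0\<close> after removing the closed
    neighbourhood of \<open>v\<close>, and \<open>N\<close> is the set of neighbours of
    \<open>v\<close> attached to \<open>C\<close>. The induction is applied to the graph induced on
    \<open>C \<union> N\<close>.\<close>
  define C where "C = {c. (c0, c) \<in> ?Q\<^sup>*}"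
  define N where "N = {x \<in> V. {x, v} \<in> E \<and> (\<exists>c\<in>C. {x, c} \<in> E)}"
  have c0C: "c0 \<in> C" by (simp add: C_def)
  have CV: "C \<subseteq> V - closed_nbhd E v"
  proof
    fix c assume "c \<in> C"
    then have "(c0, c) \<in> ?Q\<^sup>*" by (simp add: C_def)
    then show "c \<in> V - closed_nbhd E v" by (cases rule: rtranclE) (use c0 in auto)
  qed
  have nbhdC: "V \<inter> closed_nbhd E c \<subseteq> C \<union> N" if c: "c \<in> C" for c
  proof
    fix a assume a: "a \<in> V \<inter> closed_nbhd E c"
    show "a \<in> C \<union> N"
    proof (cases "a = c")
      case False
      then have ac: "{a, c} \<in> E" using a by (simp add: closed_nbhd_def)
      show ?thesis
      proof (cases "a \<in> closed_nbhd E v")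
        case True
        moreover have "a \<noteq> v" using ac CV c by (auto simp: closed_nbhd_def insert_commute)
        ultimately show ?thesis using a ac c by (auto simp: N_def closed_nbhd_def)
      next
        case False
        then have "(c, a) \<in> ?Q" using ac a c CV by (auto simp: insert_commute)
        then have "a \<in> C" using c unfolding C_def by (auto intro: rtrancl_into_rtrancl)
        then show ?thesis by simp
      qed
    qed (use c in simp)
  qed
  \<comment> \<open>Any two vertices of \<open>N\<close> are common neighbours of \<open>v\<close>
    joined by a walk through the connected set \<open>C\<close>.\<close>
  have Nclique: "{x, y} \<in> E" if xy: "x \<in> N" "y \<in> N" "x \<noteq> y" for x y
  proof -
    let ?R = "{(a, b). {a, b} \<in> E \<and> a \<in> insert x (insert y C) \<and> b \<in> insert x (insert y C)}"
    have reach: "(c0, c) \<in> ?R\<^sup>*" if "c \<in> C" for c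
    proof -
      have "(c0, c) \<in> ?Q\<^sup>*" using that unfolding C_def by blast
      then show ?thesis
      proof (induction rule: rtrancl_induct)
        case (step a b)
        have "a \<in> C" using step.hyps(1) unfolding C_def by blast
        moreover have "b \<in> C" using rtrancl_into_rtrancl[OF step.hyps] unfolding C_def by blast
        ultimately have "(a, b) \<in> ?R" using step.hyps(2) by simp
        then show ?case using step.IH by (rule rtrancl_into_rtrancl[rotated])
      qed simp
    qed
    have "sym ?R" by (auto simp: sym_def insert_commute)
    then have symR: "sym (?R\<^sup>*)" by (rule sym_rtrancl)
    obtain c d where cd: "c \<in> C" "d \<in> C" "{x, c} \<in> E" "{y, d} \<in> E" using xy by (auto simp: N_def)
    have "(x, c) \<in> ?R\<^sup>*" using cd by auto
    moreover have "(c, c0) \<in> ?R\<^sup>*" using reach[OF cd(1)] symR by (simp add: symD)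
    moreover have "(c0, d) \<in> ?R\<^sup>*" using reach[OF cd(2)] .
    moreover have "(d, y) \<in> ?R\<^sup>*" using cd by (auto simp: insert_commute)
    ultimately have "(x, y) \<in> ?R\<^sup>*" by (meson rtrancl_trans)
    then show ?thesis
      using xy CV by (intro common_neighbours_adjacent[OF psubset.prems(1) loopfree psubset.prems(2), of C x y])
        (auto simp: N_def)
  qed
  let ?H = "C \<union> N"
  have vH: "v \<notin> ?H" using CV loopfree[of v v] by (auto simp: N_def closed_nbhd_def)
  then have HV: "?H \<subset> V" using CV psubset.prems(2) by (auto simp: N_def)
  \<comment> \<open>Vertices of \<open>C\<close> have no neighbours in \<open>V\<close> outside
    \<open>C \<union> N\<close>, so for them being simplicial in the smaller graph is the same as in
    \<open>V\<close>.\<close>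
  have lift: "simplicial V E s" if "s \<in> C" "clique_in ?H E (?H \<inter> closed_nbhd E s)" for s
  proof -
    have "V \<inter> closed_nbhd E s \<subseteq> ?H \<inter> closed_nbhd E s" using nbhdC[OF that(1)] by blast
    then have "clique_in V E (V \<inter> closed_nbhd E s)"
      using clique_in_subset[OF that(2)] clique_in_mono[of ?H E _ V] HV by blast
    then show ?thesis using that(1) CV by (auto simp: simplicial_def)
  qed
  have "\<exists>s\<in>C. clique_in ?H E (?H \<inter> closed_nbhd E s)"
  proof (cases "clique_in ?H E ?H")
    case True
    then show ?thesis using c0C clique_in_subset by (metis Int_lower1)
  next
    case False
    then have "\<exists>w\<in>?H. \<not> ?H \<subseteq> closed_nbhd E w" by (rule not_clique_nonneighbour)
    \<comment> \<open>The choice of \<open>w\<close> must ensure that \<open>N\<close> lies in its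
      closed neighbourhood, so that the simplicial vertex found outside it falls in
      \<open>C\<close>. A vertex of \<open>N\<close> with a non-neighbour serves, as
      \<open>N\<close> is a clique; if there is none, every vertex of \<open>N\<close> is adjacent
      to all others, and any \<open>w\<close> with a non-neighbour serves.\<close>
    then obtain w where w: "w \<in> ?H" "\<not> ?H \<subseteq> closed_nbhd E w"
      and wN: "w \<in> N \<or> (\<forall>x\<in>N. ?H \<subseteq> closed_nbhd E x)" by blast
    have Nw: "N \<subseteq> closed_nbhd E w"
    proof (cases "w \<in> N")
      case True
      then show ?thesis using Nclique by (auto simp: closed_nbhd_def)
    next
      case False
      then show ?thesis using wN w(1) closed_nbhd_sym[of w E] by blast
    qed
    have "chordal ?H E" using chordal_subset[OF psubset.prems(1)] HV by blast
    from psubset.IH[OF HV this w]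
    obtain s where "simplicial ?H E s" "s \<notin> closed_nbhd E w" by blast
    then show ?thesis using Nw by (auto simp: simplicial_def)
  qed
  then show ?case using lift CV by blast
qed

lemma simplicial_exists:
  assumes "finite V" "chordal V E" "\<And>a b. {a, b} \<in> E \<Longrightarrow> a \<noteq> b" "V \<noteq> {}"
  shows "\<exists>s. simplicial V E s"
proof (cases "clique_in V E V")
  case True
  then show ?thesis using assms(4) clique_in_subset[OF True Int_lower1] by (auto simp: simplicial_def)
next
  case False
  then obtain v where "v \<in> V" "\<not> V \<subseteq> closed_nbhd E v"
    using not_clique_nonneighbour by blast
  with simplicial_nonneighbour_exists[OF assms(1-3)] show ?thesis by blast
qed

subsection \<open>Domination and edge deletion\<close>

lemma dominating_set_iff:
  "dominating_set V E D \<longleftrightarrow> D \<subseteq> V \<and> (\<forall>v\<in>V. \<exists>u\<in>D. u \<in> closed_nbhd E v)"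
  unfolding dominating_set_def closed_nbhd_def by blast

lemma finite_dominating_sets: "finite V \<Longrightarrow> finite {S. dominating_set V E S}"
  by (rule finite_subset[of _ "Pow V"]) (auto simp: dominating_set_def)

lemma domination_number_le:
  assumes "finite V" "dominating_set V E D"
  shows "domination_number V E \<le> card D"
  unfolding domination_number_def using assms finite_dominating_sets[of V E] by (intro Min_le) auto

lemma minimum_dominating_set_exists:
  assumes "finite V"
  shows "\<exists>D. dominating_set V E D \<and> card D = domination_number V E"
proof -
  have "V \<in> {S. dominating_set V E S}" by (simp add: dominating_set_def)
  then have "domination_number V E \<in> card ` {S. dominating_set V E S}"
    unfolding domination_number_def using finite_dominating_sets[OF assms] by (intro Min_in) auto
  then show ?thesis by auto
qed

lemma domination_number_delete_edge:
  assumes "finite V" "e \<subseteq> V" "card e = 2"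
  shows "domination_number V (F - {e}) \<le> domination_number V F + 1"
proof -
  obtain a b where e: "e = {a, b}" "a \<noteq> b" using assms(3) by (auto simp: card_2_iff)
  obtain D where D: "dominating_set V F D" "card D = domination_number V F"
    using minimum_dominating_set_exists[OF assms(1)] by blast
  \<comment> \<open>Only \<open>a\<close> and \<open>b\<close> can lose a dominator. If
    \<open>b\<close> is in \<open>D\<close>, it still dominates itself and only \<open>a\<close>
    needs repair; otherwise \<open>a\<close> did not rely on \<open>b\<close>, and adding
    \<open>b\<close> suffices.\<close>
  define c where "c = (if b \<in> D then a else b)"
  have "dominating_set V (F - {e}) (insert c D)"
    using D(1) e assms(2) unfolding dominating_set_def c_def
    by (auto simp: doubleton_eq_iff)
  then have "domination_number V (F - {e}) \<le> card (insert c D)"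
    by (rule domination_number_le[OF assms(1)])
  also have "\<dots> \<le> card D + 1" by (rule card_insert_le_m1) auto
  finally show ?thesis using D(2) by simp
qed

text \<open>The definition asks for an increase by exactly one. A smallest subset of
  \<open>A\<close> that raises the domination number achieves this: without one of its edges there
  is no increase, and that edge adds at most one.\<close>

lemma bondage_number_le:
  assumes G: "simple_graph V E" and A: "A \<subseteq> E" "domination_number V E < domination_number V (E - A)"
  shows "bondage_number V E \<le> enat (card A)"
proof -
  let ?P = "\<lambda>B. B \<subseteq> A \<and> domination_number V E < domination_number V (E - B)"
  obtain B where B: "?P B" and Bmin: "\<And>B'. ?P B' \<Longrightarrow> card B \<le> card B'"
    using ex_has_least_nat[of ?P A card] A by blast
  have finA: "finite A" using A(1) simple_graph_finite_edges[OF G] finite_subset by blast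
  then have finB: "finite B" using B finite_subset by blast
  have "B \<noteq> {}" using B by auto
  then obtain e where e: "e \<in> B" by blast
  have "card (B - {e}) < card B" using e finB by (rule card_Diff1_less[rotated])
  then have "domination_number V (E - (B - {e})) \<le> domination_number V E"
    using Bmin[of "B - {e}"] B by (meson Diff_subset not_le subset_trans)
  moreover have "E - B = E - (B - {e}) - {e}" using e by blast
  moreover have "e \<subseteq> V" "card e = 2" using e B A G by (auto simp: simple_graph_def)
  ultimately have "domination_number V (E - B) \<le> domination_number V E + 1"
    using domination_number_delete_edge[OF simple_graph_finite[OF G], of e "E - (B - {e})"] by simp
  then have "domination_number V (E - B) = domination_number V E + 1" using B by simp
  then have "bondage_number V E \<le> enat (card B)"
    unfolding bondage_number_def using B A by (intro INF_lower) auto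
  also have "\<dots> \<le> enat (card A)" using B finA by (simp add: card_mono)
  finally show ?thesis .
qed

text \<open>Delete all edges at \<open>u\<close> and those from \<open>w\<close> to
  \<open>Z\<close>. Then \<open>u\<close> must dominate itself, and \<open>w\<close> needs some
  other dominator \<open>z\<close>; by \<open>repl\<close>, a vertex \<open>z'\<close> can do the
  work of \<open>z\<close> in the original graph and dominate \<open>u\<close> as well, which saves
  one vertex.\<close>

lemma bondage_number_le_isolate:
  assumes G: "simple_graph V E" and u: "u \<in> V" and w: "w \<in> V" "w \<noteq> u" "w \<notin> Z" and Z: "finite Z"
    and repl: "\<And>z. z \<in> closed_nbhd E w \<Longrightarrow> z \<notin> Z \<Longrightarrow> z \<noteq> u \<Longrightarrow>
      \<exists>z'\<in>closed_nbhd E u. closed_nbhd E z \<subseteq> closed_nbhd E z'"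
  shows "bondage_number V E \<le> enat (card (closed_nbhd E u - {u}) + card Z)"
proof -
  define A where "A = {e \<in> E. u \<in> e} \<union> (\<lambda>z. {z, w}) ` Z \<inter> E"
  have finV: "finite V" using G by (rule simple_graph_finite)
  have finN: "finite (closed_nbhd E u - {u})"
    using closed_nbhd_subset[OF G u] finV finite_subset by blast
  have "{e \<in> E. u \<in> e} \<subseteq> (\<lambda>x. {x, u}) ` (closed_nbhd E u - {u})"
  proof
    fix e assume e: "e \<in> {e \<in> E. u \<in> e}"
    then have "card e = 2" using G by (simp add: simple_graph_def)
    then obtain x where "e = {x, u}" "x \<noteq> u" using e by (auto simp: card_2_iff)
    then show "e \<in> (\<lambda>x. {x, u}) ` (closed_nbhd E u - {u})"
      using e by (auto simp: closed_nbhd_def)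
  qed
  then have 1: "card {e \<in> E. u \<in> e} \<le> card (closed_nbhd E u - {u})"
    using finN by (meson card_image_le card_mono finite_imageI le_trans)
  have 2: "card ((\<lambda>z. {z, w}) ` Z \<inter> E) \<le> card Z"
    using Z by (meson card_image_le card_mono finite_imageI inf_le1 le_trans)
  have cardA: "card A \<le> card (closed_nbhd E u - {u}) + card Z"
    unfolding A_def using card_Un_le 1 2 by (meson add_mono le_trans)
  obtain D where D: "dominating_set V (E - A) D" "card D = domination_number V (E - A)"
    using minimum_dominating_set_exists[OF finV] by blast
  have DV: "D \<subseteq> V" and dom: "\<And>x. x \<in> V \<Longrightarrow> \<exists>d\<in>D. d \<in> closed_nbhd (E - A) x"
    using D(1) by (auto simp: dominating_set_iff)
  have finD: "finite D" using DV finV finite_subset by blast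
  have iso: "x = u" if "x \<in> closed_nbhd (E - A) u" for x
    using that by (auto simp: closed_nbhd_def A_def)
  then have uD: "u \<in> D" using dom[OF u] by blast
  have sub: "closed_nbhd (E - A) x \<subseteq> closed_nbhd E x" for x by (auto simp: closed_nbhd_def)
  obtain z where z: "z \<in> D" "z \<in> closed_nbhd (E - A) w" using dom[OF w(1)] by blast
  have zu: "z \<noteq> u" using iso[of w] z(2) w(2) by (metis closed_nbhd_sym)
  have "z \<notin> Z" using z(2) w(3) by (auto simp: closed_nbhd_def A_def)
  then obtain z' where z': "z' \<in> closed_nbhd E u" "closed_nbhd E z \<subseteq> closed_nbhd E z'"
    using repl z(2) sub zu by blast
  \<comment> \<open>Two distinct members of \<open>D\<close> are removed and at most one is added,
    which gives the strict decrease.\<close>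
  define D' where "D' = insert z' (D - {u, z})"
  have "dominating_set V E D'"
    unfolding dominating_set_iff
  proof (intro conjI ballI)
    show "D' \<subseteq> V" using DV z'(1) closed_nbhd_subset[OF G u] by (auto simp: D'_def)
    fix x assume x: "x \<in> V"
    show "\<exists>d\<in>D'. d \<in> closed_nbhd E x"
    proof (cases "x = u")
      case True
      then show ?thesis using z'(1) by (auto simp: D'_def)
    next
      case False
      obtain d where d: "d \<in> D" "d \<in> closed_nbhd (E - A) x" using dom[OF x] by blast
      have "d \<noteq> u" using d(2) iso[of x] False by (metis closed_nbhd_sym)
      show ?thesis
      proof (cases "d = z")
        case True
        then have "x \<in> closed_nbhd E z'" using d(2) sub z'(2) closed_nbhd_sym[of z E x] by blast
        then show ?thesis using closed_nbhd_sym[of z' E x] by (auto simp: D'_def)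
      next
        case False
        then show ?thesis using d sub \<open>d \<noteq> u\<close> by (auto simp: D'_def)
      qed
    qed
  qed
  then have "domination_number V E \<le> card D'" by (rule domination_number_le[OF finV])
  also have "\<dots> \<le> Suc (card (D - {u, z}))" unfolding D'_def by (rule card_insert_le_m1) auto
  also have "\<dots> < card D"
  proof -
    have "card (D - {u, z}) = card D - 2" using uD z(1) zu finD by (simp add: card_Diff_subset)
    moreover have "card {u, z} \<le> card D" using uD z(1) finD by (intro card_mono) auto
    ultimately show ?thesis using zu by simp
  qed
  finally have "domination_number V E < domination_number V (E - A)" using D(2) by simp
  then have "bondage_number V E \<le> enat (card A)"
    by (intro bondage_number_le[OF G]) (auto simp: A_def)
  also have "\<dots> \<le> enat (card (closed_nbhd E u - {u}) + card Z)" using cardA by simp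
  finally show ?thesis .
qed

section \<open>The clique number bound for chordal graphs\<close>

lemma bondage_number_le_clique_number:
  assumes G: "simple_graph V E" and "E \<noteq> {}" and ch: "chordal V E"
  shows "bondage_number V E \<le> enat (clique_number V E)"
proof -
  have finV: "finite V" using G by (rule simple_graph_finite)
  show ?thesis
  proof (cases "\<exists>u w. simplicial V E u \<and> simplicial V E w \<and> {u, w} \<in> E")
    case True
    then obtain u w where uw: "simplicial V E u" "simplicial V E w" "{u, w} \<in> E" by blast
    have V: "u \<in> V" "w \<in> V" using uw by (auto simp: simplicial_def)
    have "closed_nbhd E w \<subseteq> closed_nbhd E u"
      using uw(3) by (intro simplicial_closed_nbhd_subset[OF G uw(2)]) (simp add: closed_nbhd_def)
    \<comment> \<open>With \<open>Z\<close> empty, every dominator \<open>z\<close> of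
      \<open>w\<close> already lies in the closed neighbourhood of \<open>u\<close>, so it is its
      own replacement.\<close>
    then have "bondage_number V E \<le> enat (card (closed_nbhd E u - {u}) + card ({} :: 'a set))"
      using V edge_neq[OF G uw(3)] by (intro bondage_number_le_isolate[OF G, of u w]) auto
    also have "clique_in V E (closed_nbhd E u - {u})"
      using simplicial_closed_nbhd_clique[OF G uw(1)] clique_in_subset by blast
    from clique_card_le[OF finV this]
    have "enat (card (closed_nbhd E u - {u}) + card ({} :: 'a set)) \<le> enat (clique_number V E)"
      by (simp del: card_Diff_insert)
    finally show ?thesis .
  next
    case False
    define W where "W = {v \<in> V. \<not> simplicial V E v}"
    have WV: "W \<subseteq> V" by (auto simp: W_def)
    obtain e where "e \<in> E" using \<open>E \<noteq> {}\<close> by blast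
    then obtain a b where ab: "{a, b} \<in> E" using G by (metis card_2_iff simple_graph_def)
    then have "W \<noteq> {}" using False edge_subset[OF G ab] unfolding W_def by blast
    then obtain y where y: "simplicial W E y"
      using simplicial_exists[OF finite_subset[OF WV finV] chordal_subset[OF ch WV] edge_neq[OF G]]
      by blast
    have yV: "y \<in> V" "\<not> simplicial V E y" using y by (auto simp: simplicial_def W_def)
    define K where "K = W \<inter> closed_nbhd E y"
    have Kcl: "clique_in V E K" using y clique_in_mono[OF _ WV] by (simp add: simplicial_def K_def)
    have finK: "finite K" using finV WV finite_subset by (auto simp: K_def)
    \<comment> \<open>Otherwise the neighbourhood of \<open>y\<close> in the whole graph would be a
      clique, although \<open>y\<close> was chosen in \<open>W\<close>. A neighbour outside
      \<open>K\<close> is outside \<open>W\<close>, hence simplicial.\<close>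
    have "\<not> V \<inter> closed_nbhd E y \<subseteq> K"
      using yV Kcl clique_in_subset unfolding simplicial_def by blast
    then obtain u where u: "u \<in> closed_nbhd E y" "simplicial V E u" by (auto simp: K_def W_def)
    have uV: "u \<in> V" using u by (simp add: simplicial_def)
    have yu: "y \<in> closed_nbhd E u" using u(1) by (simp add: closed_nbhd_sym)
    have sub: "closed_nbhd E z \<subseteq> closed_nbhd E y" if "simplicial V E z" "z \<in> closed_nbhd E y" for z
      using that by (intro simplicial_closed_nbhd_subset[OF G]) (simp_all add: closed_nbhd_sym)
    \<comment> \<open>A neighbour of \<open>u\<close> is not simplicial in this case, so it lies in
      \<open>W\<close>; it is in the closed neighbourhood of \<open>y\<close> because
      \<open>u\<close> is simplicial.\<close>
    have NK: "closed_nbhd E u - {u} \<subseteq> K"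
    proof
      fix x assume x: "x \<in> closed_nbhd E u - {u}"
      then have "{u, x} \<in> E" by (auto simp: closed_nbhd_def insert_commute)
      then show "x \<in> K"
        using False u x sub[OF u(2,1)] edge_subset[OF G, of u x] by (auto simp: K_def W_def)
    qed
    have "bondage_number V E \<le> enat (card (closed_nbhd E u - {u}) + card (K - closed_nbhd E u))"
    proof (rule bondage_number_le_isolate[OF G uV yV(1)])
      fix z assume z: "z \<in> closed_nbhd E y" "z \<notin> K - closed_nbhd E u"
      \<comment> \<open>If \<open>z\<close> is in the closed neighbourhood of \<open>u\<close>, take
        \<open>z' = z\<close>. Otherwise \<open>z\<close> is outside \<open>K\<close>, hence
        simplicial, and \<open>z' = y\<close> dominates at least as much.\<close>
      show "\<exists>z'\<in>closed_nbhd E u. closed_nbhd E z \<subseteq> closed_nbhd E z'"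
      proof (cases "z \<in> closed_nbhd E u")
        case False
        then have "simplicial V E z"
          using z closed_nbhd_subset[OF G yV(1)] by (auto simp: K_def W_def)
        then show ?thesis using sub z(1) yu by blast
      qed blast
    qed (use yu u yV finK in auto)
    also have "card (closed_nbhd E u - {u}) + card (K - closed_nbhd E u)
        = card ((closed_nbhd E u - {u}) \<union> (K - closed_nbhd E u))"
      using finK finite_subset[OF NK finK] by (intro card_Un_disjoint[symmetric]) auto
    also have "\<dots> \<le> card K" using NK finK by (intro card_mono) auto
    also have "\<dots> \<le> clique_number V E" using clique_card_le[OF finV Kcl] .
    finally show ?thesis by simp
  qed
qed

subsection \<open>Complete graphs\<close>

text \<open>Split off two vertices at a time; for an odd number of vertices the last three are
  covered by two overlapping pairs. Three is a separate base case because a single leftover vertex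
  has no partner.\<close>

lemma pair_cover_exists:
  assumes "finite V" "2 \<le> card V"
  shows "\<exists>A. (\<forall>e\<in>A. e \<subseteq> V \<and> card e = 2) \<and> \<Union>A = V \<and> 2 * card A \<le> card V + 1"
  using assms
proof (induction "card V" arbitrary: V rule: less_induct)
  case less
  obtain a b where ab: "a \<in> V" "b \<in> V" "a \<noteq> b"
    using less.prems card_le_Suc0_iff_eq[of V] by fastforce
  let ?V = "V - {a, b}"
  have card: "card ?V = card V - 2" using ab less.prems by (simp add: card_Diff_subset)
  consider "card V = 2" | "card V = 3" | "4 \<le> card V" using less.prems(2) by linarith
  then show ?case
  proof cases
    case 1
    then have "?V = {}" using card less.prems by simp
    then have "V = {a, b}" using ab by blast
    then show ?thesis using ab by (intro exI[of _ "{{a, b}}"]) auto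
  next
    case 2
    then obtain c where "?V = {c}" using card by (auto simp: card_1_singleton_iff)
    then have "V = {a, b, c}" "c \<noteq> a" "c \<noteq> b" using ab by blast+
    then show ?thesis
      using ab 2 by (intro exI[of _ "{{a, b}, {a, c}}"]) (auto simp: card_insert_if)
  next
    case 3
    have "card ?V < card V" "finite ?V" "2 \<le> card ?V" using 3 card less.prems by auto
    from less.hyps[OF this]
    obtain A where A: "\<forall>e\<in>A. e \<subseteq> ?V \<and> card e = 2" "\<Union>A = ?V" "2 * card A \<le> card ?V + 1" by blast
    have "card (insert {a, b} A) \<le> card A + 1" by (rule card_insert_le_m1) auto
    then show ?thesis
      using A card 3 ab by (intro exI[of _ "insert {a, b} A"]) auto
  qed
qed

lemma domination_number_pos:
  assumes "finite V" "V \<noteq> {}"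
  shows "1 \<le> domination_number V E"
proof -
  obtain D where D: "dominating_set V E D" "card D = domination_number V E"
    using minimum_dominating_set_exists[OF assms(1)] by blast
  then have "D \<noteq> {}" "finite D" using assms finite_subset by (auto simp: dominating_set_def)
  then have "0 < card D" by (simp add: card_gt_0_iff)
  then show ?thesis using D(2) by linarith
qed

lemma domination_number_eq_1_iff:
  assumes "finite V" "V \<noteq> {}"
  shows "domination_number V E = 1 \<longleftrightarrow> (\<exists>d\<in>V. V \<subseteq> closed_nbhd E d)"
proof
  assume 1: "domination_number V E = 1"
  obtain D where D: "dominating_set V E D" "card D = 1"
    using minimum_dominating_set_exists[OF assms(1), of E] unfolding 1 by blast
  then obtain d where "D = {d}" by (auto simp: card_1_singleton_iff)
  then show "\<exists>d\<in>V. V \<subseteq> closed_nbhd E d"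
    using D(1) closed_nbhd_sym[of d E] by (auto simp: dominating_set_iff)
next
  assume "\<exists>d\<in>V. V \<subseteq> closed_nbhd E d"
  then obtain d where "d \<in> V" "V \<subseteq> closed_nbhd E d" by blast
  then have "dominating_set V E {d}" using closed_nbhd_sym[of d E] by (auto simp: dominating_set_iff)
  from domination_number_le[OF assms(1) this] domination_number_pos[OF assms, of E]
  show "domination_number V E = 1" by simp
qed

text \<open>In a complete graph, a vertex still dominates everything on its own exactly when no
  deleted edge contains it.\<close>

lemma clique_delete_edges_domination_iff:
  assumes G: "simple_graph V E" and cl: "clique_graph V E" and "V \<noteq> {}" and A: "A \<subseteq> E"
  shows "domination_number V (E - A) = 1 \<longleftrightarrow> \<not> V \<subseteq> \<Union>A"
proof -
  have *: "V \<subseteq> closed_nbhd (E - A) d \<longleftrightarrow> d \<notin> \<Union>A" if d: "d \<in> V" for d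
  proof
    assume sub: "V \<subseteq> closed_nbhd (E - A) d"
    show "d \<notin> \<Union>A"
    proof
      assume "d \<in> \<Union>A"
      then obtain e where e: "e \<in> A" "d \<in> e" by blast
      then have "card e = 2" "e \<subseteq> V" using A G by (auto simp: simple_graph_def)
      then obtain x where "e = {x, d}" "x \<noteq> d" "x \<in> V" using e(2) by (auto simp: card_2_iff)
      then show False using sub e(1) by (auto simp: closed_nbhd_def)
    qed
  next
    assume "d \<notin> \<Union>A"
    then show "V \<subseteq> closed_nbhd (E - A) d"
      using cl d by (auto simp: closed_nbhd_def clique_graph_def clique_in_def)
  qed
  show ?thesis
    using domination_number_eq_1_iff[OF simple_graph_finite[OF G] assms(3), of "E - A"] * by blast
qed

lemma bondage_number_clique:
  assumes G: "simple_graph V E" and E: "E \<noteq> {}" and cl: "clique_graph V E"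
  shows "bondage_number V E = enat (nat \<lceil>real (clique_number V E) / 2\<rceil>)"
proof -
  have finV: "finite V" using G by (rule simple_graph_finite)
  obtain e where "e \<in> E" using E by blast
  then have "e \<subseteq> V" "card e = 2" using G by (auto simp: simple_graph_def)
  then have V2: "2 \<le> card V" using card_mono[OF finV] by metis
  then have V0: "V \<noteq> {}" by auto
  obtain C where "clique_in V E C" "card C = clique_number V E"
    using maximum_clique_exists[OF finV] by blast
  then have "clique_number V E \<le> card V" using card_mono[OF finV] by (metis clique_in_def)
  then have om: "clique_number V E = card V"
    using clique_card_le[OF finV] cl unfolding clique_graph_def by (metis le_antisym)
  \<comment> \<open>The ceiling is turned into integer division so that both bounds become
    arithmetic on natural numbers.\<close>
  have num: "nat \<lceil>real n / 2\<rceil> = (n + 1) div 2" for n :: nat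
    by (cases "even n") (auto elim!: evenE oddE simp: ceiling_eq_iff intro!: nat_eq_iff[THEN iffD2])
  have gam: "domination_number V E = 1"
    using clique_delete_edges_domination_iff[OF G cl V0, of "{}"] V0 by auto
  have upper: "bondage_number V E \<le> enat ((card V + 1) div 2)"
  proof -
    obtain A where A: "\<forall>e\<in>A. e \<subseteq> V \<and> card e = 2" "\<Union>A = V" "2 * card A \<le> card V + 1"
      using pair_cover_exists[OF finV V2] by blast
    have AE: "A \<subseteq> E"
    proof
      fix e assume "e \<in> A"
      then obtain a b where "e = {a, b}" "a \<noteq> b" "a \<in> V" "b \<in> V" using A(1) by (fastforce simp: card_2_iff)
      then show "e \<in> E" using cl by (auto simp: clique_graph_def clique_in_def)
    qed
    have "domination_number V (E - A) \<noteq> 1"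
      using clique_delete_edges_domination_iff[OF G cl V0 AE] A(2) by simp
    then have "domination_number V E < domination_number V (E - A)"
      using gam domination_number_pos[OF finV V0, of "E - A"] by simp
    then have "bondage_number V E \<le> enat (card A)" by (rule bondage_number_le[OF G AE])
    also have "\<dots> \<le> enat ((card V + 1) div 2)" using A(3) by simp
    finally show ?thesis .
  qed
  have lower: "enat ((card V + 1) div 2) \<le> bondage_number V E"
    unfolding bondage_number_def
  proof (rule INF_greatest)
    fix A assume "A \<in> {A. A \<subseteq> E \<and> domination_number V (E - A) = domination_number V E + 1}"
    then have A: "A \<subseteq> E" "domination_number V (E - A) \<noteq> 1" using gam by auto
    have cov: "V \<subseteq> \<Union>A" using clique_delete_edges_domination_iff[OF G cl V0 A(1)] A(2) by blast
    have finA: "finite A" using A(1) simple_graph_finite_edges[OF G] finite_subset by blast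
    have two: "card e = 2 \<and> finite e" if "e \<in> A" for e
    proof -
      have "card e = 2" using that A(1) G by (auto simp: simple_graph_def)
      then show ?thesis using card_ge_0_finite[of e] by simp
    qed
    \<comment> \<open>Each deleted edge covers two vertices, so covering \<open>V\<close> takes at
      least half as many edges as vertices.\<close>
    have "card V \<le> card (\<Union>A)" using cov finA two by (intro card_mono) auto
    also have "\<dots> \<le> (\<Sum>e\<in>A. card e)" using two by (intro card_Union_le_sum_card)
    also have "\<dots> = 2 * card A" using two by simp
    finally show "enat ((card V + 1) div 2) \<le> enat (card A)" by simp
  qed
  show ?thesis unfolding om num using upper lower by (rule antisym)
qed

section \<open>Clique number and maximum degree\<close>

text \<open>A maximum clique is not all of \<open>V\<close>, so by connectedness some edge leaves
  it. The endpoint inside has all other clique members and one outside vertex as neighbours.\<close>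

lemma clique_number_le_max_degree:
  assumes G: "simple_graph V E" and conn: "connected_graph V E" and ncl: "\<not> clique_graph V E"
  shows "clique_number V E \<le> max_degree V E"
proof -
  have finV: "finite V" using G by (rule simple_graph_finite)
  obtain C where C: "clique_in V E C" "card C = clique_number V E"
    using maximum_clique_exists[OF finV] by blast
  have CV: "C \<subseteq> V" using C(1) by (simp add: clique_in_def)
  have "C \<noteq> V" using C(1) ncl by (auto simp: clique_graph_def)
  then obtain b where b: "b \<in> V" "b \<notin> C" using CV by blast
  have "clique_in V E {b}" using b by (simp add: clique_in_def)
  then have "1 \<le> card C" using clique_card_le[OF finV] C(2) by fastforce
  then obtain a where a: "a \<in> C" by fastforce
  have "(a, b) \<in> {(x, y). {x, y} \<in> E}\<^sup>*" using conn a b CV by (auto simp: connected_graph_def)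
  then have "\<exists>c\<in>C. \<exists>d. d \<notin> C \<and> {c, d} \<in> E"
    using b(2)
  proof (induction rule: rtrancl_induct)
    case base
    then show ?case using a by simp
  next
    case (step y z)
    then show ?case by (cases "y \<in> C") auto
  qed
  then obtain c d where cd: "c \<in> C" "d \<notin> C" "{c, d} \<in> E" by blast
  \<comment> \<open>Exchanging \<open>c\<close> for \<open>d\<close> keeps the cardinality of
    \<open>C\<close> and yields only neighbours of \<open>c\<close>.\<close>
  have "insert d (C - {c}) \<subseteq> {u. {u, c} \<in> E}"
    using C(1) cd by (auto simp: clique_in_def insert_commute)
  moreover have "finite {u. {u, c} \<in> E}"
    by (rule finite_subset[OF _ finV]) (use edge_subset[OF G] in blast)
  ultimately have "card (insert d (C - {c})) \<le> vertex_degree E c"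
    unfolding vertex_degree_def by (rule card_mono[rotated])
  moreover have "finite C" using CV finV finite_subset by blast
  then have "card (insert d (C - {c})) = card C"
    using cd card.remove[of C c] by simp
  moreover have "vertex_degree E c \<le> max_degree V E"
    unfolding max_degree_def using finV cd(1) CV by (intro Max_ge) auto
  ultimately show ?thesis using C(2) by simp
qed

text \<open>Edgeless graphs are excluded because their bondage number is infinite. Connectedness is
  attached only to the degree bound, which fails for two disjoint copies of one complete
  graph.\<close>

theorem theorem3:
  fixes V :: "'a set" and E :: "'a set set"
  assumes "simple_graph V E"
    and "E \<noteq> {}"
    and "chordal V E"
  shows "(clique_graph V E \<longrightarrow>
            bondage_number V E = enat (nat \<lceil>real (clique_number V E) / 2\<rceil>)) \<and>
         (\<not> clique_graph V E \<longrightarrow>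
            bondage_number V E \<le> enat (clique_number V E) \<and>
            (connected_graph V E \<longrightarrow> clique_number V E \<le> max_degree V E))"
  using bondage_number_clique bondage_number_le_clique_number clique_number_le_max_degree assms
  by blast

end
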